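(* Let $f(t)=\left[2t^{4/3}+\left(2\sqrt{t(1-t)}\right)^{4/3}\right]^{3/4}$ (for $t\in[0,1]$), and let $$t_0=\frac{1}{36}\left(2\sqrt[3]{107+9\sqrt{129}}+\sqrt[3]{856-72\sqrt{129}}+16\right)\approx 0.867835.$$ Then $D_{\mathbb{R},2}(2)=f(t_0)\approx 1.837373$. The exact value of $f(t_0)$ is $$\left(\frac{\left(2\sqrt[3]{107+9\sqrt{129}}+\sqrt[3]{856-72\sqrt{129}}+16\right)^{4/3}}{18\cdot 6^{2/3}}+\frac{1}{9\left(-\frac{3}{X}\right)^{2/3}}\right)^{3/4},$$ where $$X=-2\sqrt[3]{107+9\sqrt{129}}+\left(107+9\sqrt{129}\right)^{2/3}-2\sqrt[3]{107-9\sqrt{129}}+\left(107-9\sqrt{129}\right)^{2/3}-60.$$ Moreover, the following normalized polynomials (for all choices of signs) are extreme for this problem: $$P_2(x,y)=\pm\left(t_0x^2-t_0y^2\pm 2\sqrt{t_0(1-t_0)}\,xy\right),$$ that is, $\|P_2\|=1$ and $|P_2|_{4/3}=D_{\mathbb{R},2}(2)$.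
   Context: For a real $2$-homogeneous polynomial $P(x,y)=ax^2+bxy+cy^2$ with $a,b,c\in\mathbb{R}$, put $$\|P\|=\sup\{|P(x,y)| : (x,y)\in[-1,1]^2\},\qquad |P|_{4/3}=\left(|a|^{4/3}+|b|^{4/3}+|c|^{4/3}\right)^{3/4}.$$ The constant $D_{\mathbb{R},2}(2)$ is defined as $$D_{\mathbb{R},2}(2)=\inf\{D>0 : |P|_{4/3}\le D\|P\|\ \text{for all } P(x,y)=ax^2+bxy+cy^2,\ a,b,c\in\mathbb{R}\}.$$ All cube roots are real. *)

theory Defs
  imports "HOL-Analysis.Analysis"
begin

(* The 2-homogeneous polynomial a x^2 + b x y + c y^2 is given by its coefficients a, b, c,
   with b the coefficient of the mixed term. *)

definition quad :: "real \<Rightarrow> real \<Rightarrow> real \<Rightarrow> real \<Rightarrow> real \<Rightarrow> real" where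
  "quad a b c x y = a * x\<^sup>2 + b * x * y + c * y\<^sup>2"

definition quad_norm :: "real \<Rightarrow> real \<Rightarrow> real \<Rightarrow> real" where
  "quad_norm a b c = (SUP (x, y) \<in> {-1..1} \<times> {-1..1}. \<bar>quad a b c x y\<bar>)"

definition coeff_norm :: "real \<Rightarrow> real \<Rightarrow> real \<Rightarrow> real" where
  "coeff_norm a b c =
     (\<bar>a\<bar> powr (4/3) + \<bar>b\<bar> powr (4/3) + \<bar>c\<bar> powr (4/3)) powr (3/4)"

definition D_R2_2 :: real where
  "D_R2_2 = Inf {D. D > 0 \<and> (\<forall>a b c. coeff_norm a b c \<le> D * quad_norm a b c)}"

(* Only meaningful for t in [0,1], where all bases of powr are nonnegative. *)

definition f :: "real \<Rightarrow> real" where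
  "f t = (2 * t powr (4/3) + (2 * sqrt (t * (1 - t))) powr (4/3)) powr (3/4)"

definition t0 :: real where
  "t0 = 1/36 * (2 * root 3 (107 + 9 * sqrt 129) + root 3 (856 - 72 * sqrt 129) + 16)"

(* 107 - 9 sqrt 129 is about 4.78, so both bases of powr are positive.
   X itself is about -37.16, so -3/X is positive as well. *)

definition X :: real where
  "X = - 2 * root 3 (107 + 9 * sqrt 129) + (107 + 9 * sqrt 129) powr (2/3)
       - 2 * root 3 (107 - 9 * sqrt 129) + (107 - 9 * sqrt 129) powr (2/3) - 60"

end

theory Submission
  imports Defs
begin

text \<open>
  Let \<open>|P| \<le> 1\<close> on the square and, up to swapping \<open>x\<close> and \<open>y\<close>, \<open>|c| \<le> |a|\<close>. If \<open>|a| \<ge> 1/2\<close>,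
  evaluating \<open>P\<close> at \<open>(1, b/(2a))\<close> gives \<open>|a| + b\<^sup>2/(4|a|) \<le> 1\<close>; if \<open>|a| < 1/2\<close>, then \<open>|b| \<le> 1\<close>
  is enough. Either way the coefficients are dominated by those of
  \<open>t x\<^sup>2 + 2 sqrt (t (1 - t)) x y - t y\<^sup>2\<close> with \<open>t = max (|a|) (1/2)\<close>, so that
  \<open>|P|\<^bsub>4/3\<^esub> \<le> f t\<close>. The sign of the derivative of \<open>f\<close> is opposite to that of
  \<open>12 t\<^sup>3 - 16 t\<^sup>2 + 6 t - 1\<close>, whose only real root \<open>t0\<close> is given by Cardano's formula.
\<close>

section \<open>The critical cubic and its real root \<open>t0\<close>\<close>

definition cubic :: "real \<Rightarrow> real" where
  "cubic t = 12 * t ^ 3 - 16 * t\<^sup>2 + 6 * t - 1"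

text \<open>Cardano's formula: \<open>u * v = 10\<close> and \<open>u ^ 3 + v ^ 3 = 214\<close> give
  a depressed cubic for \<open>s = u + v\<close>, and the shift \<open>t = (s + 8) / 18\<close>
  turns \<open>cubic t\<close> into \<open>(s ^ 3 - 30 * s - 214) / 486\<close>. Writing
  \<open>X\<close> in terms of \<open>s\<close> as well prepares the closed form of
  \<open>f t0\<close>.\<close>

lemma t0_cardano:
  fixes u v :: real
  defines "u \<equiv> root 3 (107 + 9 * sqrt 129)" and "v \<equiv> root 3 (107 - 9 * sqrt 129)"
  shows "(u + v) ^ 3 = 214 + 30 * (u + v)" "t0 = (u + v + 8) / 18"
    "X = (u + v)\<^sup>2 - 2 * (u + v) - 80"
proof -
  have pos: "107 - 9 * sqrt 129 > 0"
  proof -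
    have "sqrt 129 < 107 / 9"
      by (rule real_less_lsqrt) (auto simp: power2_eq_square)
    then show ?thesis by simp
  qed
  have pos': "107 + 9 * sqrt 129 > 0"
    by (simp add: add_pos_nonneg)
  have "u * v = root 3 ((107 + 9 * sqrt 129) * (107 - 9 * sqrt 129))"
    unfolding u_def v_def by (simp add: real_root_mult)
  also have "(107 + 9 * sqrt 129) * (107 - 9 * sqrt 129) = 10 ^ 3"
    by (simp add: algebra_simps)
  finally have uv: "u * v = 10"
    by (simp add: real_root_power_cancel)
  have cubes: "u ^ 3 = 107 + 9 * sqrt 129" "v ^ 3 = 107 - 9 * sqrt 129"
    unfolding u_def v_def using pos pos' by (simp_all add: odd_real_root_pow)
  have "(u + v) ^ 3 = u ^ 3 + v ^ 3 + 3 * (u * v) * (u + v)"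
    by algebra
  then show "(u + v) ^ 3 = 214 + 30 * (u + v)"
    by (simp add: cubes uv)
  have "root 3 (856 - 72 * sqrt 129) = root 3 (2 ^ 3 * (107 - 9 * sqrt 129))"
    by simp
  also have "\<dots> = 2 * v"
    by (simp only: real_root_mult v_def) (simp add: real_root_power_cancel)
  finally show "t0 = (u + v + 8) / 18"
    unfolding t0_def u_def[symmetric] by simp
  \<comment> \<open>\<open>X\<close> is stated with \<open>powr\<close>, which is matched with
    squares of cube roots for positive bases; hence the sign checks at the start.\<close>
  have sq: "x powr (2/3) = (root 3 x)\<^sup>2" if "x > 0" for x :: real
    using that by (simp add: root_powr_inverse powr_powr flip: powr_numeral)
  have "(u + v)\<^sup>2 = u\<^sup>2 + v\<^sup>2 + 2 * (u * v)"
    by algebra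
  then show "X = (u + v)\<^sup>2 - 2 * (u + v) - 80"
    unfolding X_def using sq[OF pos] sq[OF pos'] uv by (simp add: u_def v_def)
qed

lemma cubic_t0: "cubic t0 = 0"
  unfolding cubic_def t0_cardano(2) using t0_cardano(1)
  by (simp add: power2_eq_square power3_eq_cube field_simps)

lemma cubic_diff:
  "cubic t - cubic s = (t - s) * (12 * (t\<^sup>2 + t * s + s\<^sup>2) - 16 * (t + s) + 6)"
  unfolding cubic_def by algebra

text \<open>Completing the square in \<open>t\<close> leaves
  \<open>9 * s\<^sup>2 - 8 * s + 2/3\<close>, which is positive for \<open>s\<close> above about
  0.796. The value 43/50 is a convenient rational between that and \<open>t0\<close>; the remainder
  is expanded around it.\<close>

lemma cubic_quotient_pos:
  fixes t s :: real
  assumes "s \<ge> 43/50"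
  shows "12 * (t\<^sup>2 + t * s + s\<^sup>2) - 16 * (t + s) + 6 > 0"
proof -
  have "12 * (t\<^sup>2 + t * s + s\<^sup>2) - 16 * (t + s) + 6
      = 12 * (t + s / 2 - 2/3)\<^sup>2 + 9 * (s - 43/50)\<^sup>2 + 187/25 * (s - 43/50) + 3323/7500"
    by (simp add: power2_eq_square field_simps)
  also have "\<dots> > 0"
    using assms by (intro add_nonneg_pos add_nonneg_nonneg) auto
  finally show ?thesis .
qed

text \<open>Only one of the two points has to be large, because the quotient is positive for every
  \<open>t\<close>. Hence \<open>t0\<close> can be compared with a rational \<open>s\<close> before
  anything is known about its size.\<close>

lemma cubic_less_iff:
  assumes "s \<ge> 43/50"
  shows "cubic t < cubic s \<longleftrightarrow> t < s"
  using cubic_diff[of t s] cubic_quotient_pos[OF assms, of t]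
  by (metis diff_less_0_iff_less mult_less_0_iff not_less_iff_gr_or_eq)

text \<open>A sign test of \<open>cubic\<close> at two rationals around the root, so that no radical
  has to be estimated.\<close>

lemma t0_bounds: "86783528/10^8 < t0" "t0 < 867835281/10^9"
proof -
  have neg: "cubic (86783528/10^8) < 0" and pos: "cubic (867835281/10^9) > 0"
    by (simp_all add: cubic_def power2_eq_square power3_eq_cube)
  show "t0 < 867835281/10^9"
    using pos cubic_less_iff[of "867835281/10^9" t0] by (simp add: cubic_t0)
  have "t0 \<noteq> 86783528/10^8"
    using neg cubic_t0 by (metis less_irrefl)
  moreover have "\<not> t0 < 86783528/10^8"
    using neg cubic_less_iff[of "86783528/10^8" t0] by (simp add: cubic_t0)
  ultimately show "86783528/10^8 < t0" by linarith
qed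

section \<open>Maximising \<open>f\<close> on the unit interval\<close>

text \<open>On [0,1] this is \<open>f t powr (4/3)\<close>, with the square root absorbed into the
  exponent.\<close>

definition g :: "real \<Rightarrow> real" where
  "g t = 2 * t powr (4/3) + (4 * (t * (1 - t))) powr (2/3)"

lemma f_eq_g:
  assumes "0 \<le> t" "t \<le> 1"
  shows "f t = g t powr (3/4)"
proof -
  have "2 * sqrt (t * (1 - t)) = sqrt (4 * (t * (1 - t)))"
    by (simp add: real_sqrt_mult)
  also have "\<dots> = (4 * (t * (1 - t))) powr (1/2)"
    using assms by (simp add: powr_half_sqrt)
  finally show ?thesis
    by (simp add: f_def g_def powr_powr)
qed

lemma g_nonneg: "g t \<ge> 0"
  by (simp add: g_def)

lemma powr_thirds_cube:
  fixes x :: real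
  assumes "x \<ge> 0" "m > 0"
  shows "(x powr (real m / 3)) ^ 3 = x ^ m"
proof (cases "x = 0")
  case False
  with assms have "(x powr (real m / 3)) ^ 3 = x powr real m"
    by (simp add: powr_powr flip: powr_numeral)
  with False assms show ?thesis by (simp add: powr_realpow)
qed (use assms in simp)

lemma continuous_on_g: "continuous_on {0..1} g"
  unfolding g_def by (intro continuous_intros continuous_on_powr') auto

text \<open>Pulling out the positive factor \<open>w powr (-1/3)\<close> with
  \<open>w = 4 * (t * (1 - t))\<close> leaves a difference of a cube root and a polynomial, whose
  sign is decided by cubing.\<close>

lemma g_deriv:
  assumes "0 < t" "t < 1"
  shows "(g has_real_derivative
    (8/3) * (4 * (t * (1 - t))) powr (-1/3) * (root 3 (4 * t\<^sup>2 * (1 - t)) - (2 * t - 1))) (at t)"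
proof -
  define w where "w = 4 * (t * (1 - t))"
  have w: "w > 0" using assms by (simp add: w_def)
  have "root 3 (4 * t\<^sup>2 * (1 - t)) = root 3 (t * w)"
    by (simp add: w_def power2_eq_square mult_ac)
  also have "\<dots> = t powr (1/3) * w powr (1/3)"
    using assms w by (simp add: root_powr_inverse powr_mult)
  finally have "w powr (-1/3) * root 3 (4 * t\<^sup>2 * (1 - t)) = t powr (1/3) * (w powr (1/3) * w powr (-1/3))"
    by (simp only: mult_ac)
  also have "w powr (1/3) * w powr (-1/3) = 1"
    using w by (simp flip: powr_add)
  finally have "w powr (-1/3) * root 3 (4 * t\<^sup>2 * (1 - t)) = t powr (1/3)"
    by simp
  then have "(8/3) * (w powr (-1/3) * root 3 (4 * t\<^sup>2 * (1 - t))) = (8/3) * t powr (1/3)"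
    by (simp only:)
  moreover have "4/3 - 1 = (1/3 :: real)" "2/3 - 1 = (-1/3 :: real)"
    by simp_all
  ultimately have eq: "(8/3) * w powr (-1/3) * (root 3 (4 * t\<^sup>2 * (1 - t)) - (2 * t - 1))
      = 2 * (4/3 * t powr (4/3 - 1)) + 2/3 * w powr (2/3 - 1) * (4 * (1 - 2 * t))"
    by (simp only:) algebra
  have "((\<lambda>t. 4 * (t * (1 - t))) has_real_derivative 4 * (1 - 2 * t)) (at t)"
    by (auto intro!: derivative_eq_intros)
  then have "((\<lambda>t. (4 * (t * (1 - t))) powr (2/3)) has_real_derivative
      2/3 * w powr (2/3 - 1) * (4 * (1 - 2 * t))) (at t)"
    unfolding w_def
    by (rule DERIV_chain2[OF has_real_derivative_powr, rotated]) (use w in \<open>simp add: w_def\<close>)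
  then have "((\<lambda>t. 2 * t powr (4/3) + (4 * (t * (1 - t))) powr (2/3)) has_real_derivative
      2 * (4/3 * t powr (4/3 - 1)) + 2/3 * w powr (2/3 - 1) * (4 * (1 - 2 * t))) (at t)"
    by (intro DERIV_add DERIV_cmult has_real_derivative_powr assms)
  then show ?thesis
    unfolding g_def[abs_def] eq[unfolded w_def] w_def .
qed

text \<open>The real cube root is increasing on the whole line, so cubing takes no case split on the
  sign of \<open>2 * t - 1\<close>, and \<open>(2 * t - 1) ^ 3 - 4 * t\<^sup>2 * (1 - t)\<close> is
  exactly \<open>cubic t\<close>.\<close>

lemma root_minus_nonneg_iff:
  "root 3 (4 * t\<^sup>2 * (1 - t)) - (2 * t - 1) \<ge> 0 \<longleftrightarrow> cubic t \<le> 0"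
proof -
  have "2 * t - 1 \<le> root 3 (4 * t\<^sup>2 * (1 - t))
      \<longleftrightarrow> root 3 ((2 * t - 1) ^ 3) \<le> root 3 (4 * t\<^sup>2 * (1 - t))"
    by (simp add: odd_real_root_power_cancel)
  also have "\<dots> \<longleftrightarrow> (2 * t - 1) ^ 3 \<le> 4 * t\<^sup>2 * (1 - t)"
    by simp
  also have "\<dots> \<longleftrightarrow> cubic t \<le> 0"
    by (simp add: cubic_def power2_eq_square power3_eq_cube algebra_simps)
  finally show ?thesis by simp
qed

text \<open>\<open>g\<close> rises up to \<open>t0\<close> and falls after it. It is not
  differentiable at 0 and 1, so the derivative is used on open intervals and continuity covers the
  endpoints.\<close>

lemma g_le_g_t0:
  assumes "0 \<le> t" "t \<le> 1"
  shows "g t \<le> g t0"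
proof (cases "t \<le> t0")
  case True
  show ?thesis
  proof (rule DERIV_nonneg_imp_increasing_open[OF True])
    fix x assume x: "t < x" "x < t0"
    then have "cubic x \<le> 0"
      using cubic_less_iff[of t0 x] t0_bounds by (simp add: cubic_t0)
    then have "root 3 (4 * x\<^sup>2 * (1 - x)) - (2 * x - 1) \<ge> 0"
      by (simp only: root_minus_nonneg_iff)
    then have "8/3 * (4 * (x * (1 - x))) powr (-1/3) * (root 3 (4 * x\<^sup>2 * (1 - x)) - (2 * x - 1)) \<ge> 0"
      by (intro mult_nonneg_nonneg) auto
    moreover have "0 < x" "x < 1" using x assms t0_bounds by auto
    ultimately show "\<exists>y. (g has_real_derivative y) (at x) \<and> y \<ge> 0"
      using g_deriv[of x] by blast
  next
    show "continuous_on {t..t0} g"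
      using assms t0_bounds by (intro continuous_on_subset[OF continuous_on_g]) auto
  qed
next
  case False
  then have "t0 \<le> t" by simp
  then show ?thesis
  proof (rule DERIV_nonpos_imp_decreasing_open)
    fix x assume x: "t0 < x" "x < t"
    then have "cubic x > 0"
      using cubic_less_iff[of x t0] t0_bounds by (simp add: cubic_t0)
    then have "root 3 (4 * x\<^sup>2 * (1 - x)) - (2 * x - 1) \<le> 0"
      using root_minus_nonneg_iff[of x] by linarith
    then have "8/3 * (4 * (x * (1 - x))) powr (-1/3) * (root 3 (4 * x\<^sup>2 * (1 - x)) - (2 * x - 1)) \<le> 0"
      by (intro mult_nonneg_nonpos) auto
    moreover have "0 < x" "x < 1" using x assms t0_bounds by auto
    ultimately show "\<exists>y. (g has_real_derivative y) (at x) \<and> y \<le> 0"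
      using g_deriv[of x] by blast
  next
    show "continuous_on {t0..t} g"
      using assms t0_bounds by (intro continuous_on_subset[OF continuous_on_g]) auto
  qed
qed


section \<open>The supremum norm on the square\<close>

lemma quad_le_quad_norm:
  assumes "\<bar>x\<bar> \<le> 1" "\<bar>y\<bar> \<le> 1"
  shows "\<bar>quad a b c x y\<bar> \<le> quad_norm a b c"
proof -
  have "\<bar>quad a b c x y\<bar> \<le> \<bar>a\<bar> + \<bar>b\<bar> + \<bar>c\<bar>" if "(x, y) \<in> {-1..1} \<times> {-1..1}" for x y
  proof -
    have "\<bar>x\<bar> \<le> 1" "\<bar>y\<bar> \<le> 1" using that by auto
    then have "x\<^sup>2 \<le> 1" "\<bar>x\<bar> * \<bar>y\<bar> \<le> 1" "y\<^sup>2 \<le> 1"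
      by (simp_all add: abs_square_le_1 mult_le_one)
    then have "\<bar>a * x\<^sup>2\<bar> \<le> \<bar>a\<bar>" "\<bar>b * x * y\<bar> \<le> \<bar>b\<bar>" "\<bar>c * y\<^sup>2\<bar> \<le> \<bar>c\<bar>"
      by (simp_all add: abs_mult mult.assoc mult_left_le)
    then show ?thesis unfolding quad_def by linarith
  qed
  \<comment> \<open>A real supremum bounds its set only if the set is bounded above.\<close>
  then have "bdd_above ((\<lambda>(x, y). \<bar>quad a b c x y\<bar>) ` ({-1..1} \<times> {-1..1}))"
    by (intro bdd_aboveI2[where M = "\<bar>a\<bar> + \<bar>b\<bar> + \<bar>c\<bar>"]) auto
  then show ?thesis
    unfolding quad_norm_def using assms
    by (intro cSUP_upper2[where x = "(x, y)"]) auto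
qed

lemma quad_norm_eq_1I:
  assumes "\<And>x y. \<lbrakk>\<bar>x\<bar> \<le> 1; \<bar>y\<bar> \<le> 1\<rbrakk> \<Longrightarrow> \<bar>quad a b c x y\<bar> \<le> 1"
    and "\<bar>x\<bar> \<le> 1" "\<bar>y\<bar> \<le> 1" "\<bar>quad a b c x y\<bar> = 1"
  shows "quad_norm a b c = 1"
proof (rule antisym)
  show "quad_norm a b c \<le> 1"
    unfolding quad_norm_def using assms(1) by (intro cSUP_least) auto
  show "1 \<le> quad_norm a b c"
    using quad_le_quad_norm[OF assms(2,3), of a b c] assms(4) by simp
qed

section \<open>The upper bound for the coefficient norm\<close>

lemma mixed_coeff_bound:
  assumes le: "\<And>x y. \<lbrakk>\<bar>x\<bar> \<le> 1; \<bar>y\<bar> \<le> 1\<rbrakk> \<Longrightarrow> \<bar>quad a b c x y\<bar> \<le> 1"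
    and "\<bar>c\<bar> \<le> \<bar>a\<bar>" "1/2 \<le> \<bar>a\<bar>"
  shows "b\<^sup>2 \<le> 4 * (\<bar>a\<bar> * (1 - \<bar>a\<bar>))"
proof -
  have a: "a \<noteq> 0" using assms by auto
  \<comment> \<open>The values at (1,1) and (1,-1) differ by \<open>2 * b\<close>.\<close>
  have "\<bar>b\<bar> \<le> 1"
    using le[of 1 1] le[of 1 "-1"] by (simp add: quad_def)
  \<comment> \<open>With \<open>\<bar>b\<bar> \<le> 1 \<le> 2 * \<bar>a\<bar>\<close> this point
    stays in the square, and \<open>b * y = 2 * a * y\<^sup>2\<close> has the sign of
    \<open>a\<close>, so it adds to the leading term.\<close>
  define y where "y = b / (2 * a)"
  have "\<bar>y\<bar> \<le> 1"
    using \<open>\<bar>b\<bar> \<le> 1\<close> assms(3) a by (simp add: y_def abs_mult divide_le_eq)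
  have b_eq: "b = 2 * a * y" using a by (simp add: y_def)
  have "\<bar>a\<bar> * (1 + 2 * y\<^sup>2) - \<bar>c\<bar> * y\<^sup>2 = \<bar>a * (1 + 2 * y\<^sup>2)\<bar> - \<bar>c * y\<^sup>2\<bar>"
    by (simp add: abs_mult)
  also have "\<dots> \<le> \<bar>a * (1 + 2 * y\<^sup>2) + c * y\<^sup>2\<bar>" by linarith
  also have "\<dots> = \<bar>quad a b c 1 y\<bar>"
    by (simp add: quad_def b_eq power2_eq_square algebra_simps)
  also have "\<dots> \<le> 1"
    using \<open>\<bar>y\<bar> \<le> 1\<close> by (intro le) auto
  finally have "\<bar>a\<bar> * (1 + 2 * y\<^sup>2) - \<bar>c\<bar> * y\<^sup>2 \<le> 1" .
  moreover have "\<bar>c\<bar> * y\<^sup>2 \<le> \<bar>a\<bar> * y\<^sup>2"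
    using assms(2) by (intro mult_right_mono) auto
  ultimately have "\<bar>a\<bar> * y\<^sup>2 \<le> 1 - \<bar>a\<bar>"
    by (simp add: algebra_simps)
  then have "4 * \<bar>a\<bar> * (\<bar>a\<bar> * y\<^sup>2) \<le> 4 * \<bar>a\<bar> * (1 - \<bar>a\<bar>)"
    by (intro mult_left_mono) auto
  moreover have "b\<^sup>2 = 4 * (\<bar>a\<bar> * \<bar>a\<bar>) * y\<^sup>2"
    by (simp add: b_eq power_mult_distrib power2_eq_square)
  ultimately show ?thesis
    by (simp only: mult_ac)
qed

lemma coeff_norm_le_f_t0:
  assumes le: "\<And>x y. \<lbrakk>\<bar>x\<bar> \<le> 1; \<bar>y\<bar> \<le> 1\<rbrakk> \<Longrightarrow> \<bar>quad a b c x y\<bar> \<le> 1"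
  shows "coeff_norm a b c \<le> f t0"
proof -
  \<comment> \<open>The floor 1/2 makes \<open>4 * (t * (1 - t)) = 1\<close> when both outer
    coefficients are small, so that \<open>\<bar>b\<bar> \<le> 1\<close> suffices there.\<close>
  define t where "t = max (max \<bar>a\<bar> \<bar>c\<bar>) (1/2)"
  have ac: "\<bar>a\<bar> \<le> 1" "\<bar>c\<bar> \<le> 1"
    using le[of 1 0] le[of 0 1] by (simp_all add: quad_def)
  have t: "0 \<le> t" "t \<le> 1" "\<bar>a\<bar> \<le> t" "\<bar>c\<bar> \<le> t"
    using ac by (auto simp: t_def)
  have "b\<^sup>2 \<le> 4 * (t * (1 - t))"
  proof -
    consider "t = 1/2" | "t = \<bar>a\<bar>" "\<bar>c\<bar> \<le> \<bar>a\<bar>" "1/2 \<le> \<bar>a\<bar>" | "t = \<bar>c\<bar>" "\<bar>a\<bar> \<le> \<bar>c\<bar>" "1/2 \<le> \<bar>c\<bar>"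
      unfolding t_def by linarith
    then show ?thesis
    proof cases
      case 1
      have "\<bar>b\<bar> \<le> 1"
        using le[of 1 1] le[of 1 "-1"] by (simp add: quad_def)
      then show ?thesis by (simp add: 1 abs_square_le_1)
    next
      case 2
      then show ?thesis using mixed_coeff_bound[OF le] by simp
    next
      case 3
      \<comment> \<open>Swapping the variables exchanges the outer coefficients and preserves the
        square.\<close>
      have "\<bar>quad c b a x y\<bar> \<le> 1" if "\<bar>x\<bar> \<le> 1" "\<bar>y\<bar> \<le> 1" for x y
        using le[OF that(2,1)] by (simp add: quad_def algebra_simps)
      then show ?thesis using 3 mixed_coeff_bound[of c b a] by simp
    qed
  qed
  then have "(b\<^sup>2) powr (2/3) \<le> (4 * (t * (1 - t))) powr (2/3)"
    by (intro powr_mono2) auto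
  moreover have "(b\<^sup>2) powr (2/3) = \<bar>b\<bar> powr (4/3)"
  proof (cases "b = 0")
    case False
    then have "b\<^sup>2 = \<bar>b\<bar> powr 2" by simp
    then show ?thesis by (simp only: powr_powr) simp
  qed simp
  moreover have "\<bar>a\<bar> powr (4/3) \<le> t powr (4/3)" "\<bar>c\<bar> powr (4/3) \<le> t powr (4/3)"
    using t by (auto intro!: powr_mono2)
  ultimately have "\<bar>a\<bar> powr (4/3) + \<bar>b\<bar> powr (4/3) + \<bar>c\<bar> powr (4/3) \<le> g t"
    by (simp add: g_def)
  also have "\<dots> \<le> g t0"
    using t by (intro g_le_g_t0)
  finally show ?thesis
    unfolding coeff_norm_def using t0_bounds
    by (subst f_eq_g) (auto intro!: powr_mono2)
qed

lemma quad_scale: "quad (r * a) (r * b) (r * c) x y = r * quad a b c x y"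
  by (simp add: quad_def algebra_simps)

lemma coeff_norm_scale: "coeff_norm (r * a) (r * b) (r * c) = \<bar>r\<bar> * coeff_norm a b c"
proof -
  have "\<bar>r * a\<bar> powr (4/3) + \<bar>r * b\<bar> powr (4/3) + \<bar>r * c\<bar> powr (4/3)
      = \<bar>r\<bar> powr (4/3) * (\<bar>a\<bar> powr (4/3) + \<bar>b\<bar> powr (4/3) + \<bar>c\<bar> powr (4/3))"
    by (simp add: abs_mult powr_mult algebra_simps)
  then show ?thesis
    by (simp add: coeff_norm_def powr_mult powr_powr)
qed

text \<open>Both sides are homogeneous in the coefficients, so division by the norm reduces to the
  bound for polynomials of norm at most 1. A polynomial of norm 0 vanishes at (1,0), (0,1) and
  (1,1), hence is zero.\<close>

lemma coeff_norm_le_quad_norm: "coeff_norm a b c \<le> f t0 * quad_norm a b c"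
proof -
  define N where "N = quad_norm a b c"
  have N: "\<bar>quad a b c x y\<bar> \<le> N" if "\<bar>x\<bar> \<le> 1" "\<bar>y\<bar> \<le> 1" for x y
    using quad_le_quad_norm[OF that] by (simp add: N_def)
  have "N \<ge> 0" using N[of 0 0] by simp
  then consider "N = 0" | "N > 0" by linarith
  then show ?thesis
  proof cases
    case 1
    then have "a = 0" "b = 0" "c = 0"
      using N[of 1 0] N[of 0 1] N[of 1 1] by (auto simp: quad_def)
    then have "coeff_norm a b c = 0" by (simp add: coeff_norm_def)
    with 1 show ?thesis by (simp add: N_def)
  next
    case 2
    have "coeff_norm (1/N * a) (1/N * b) (1/N * c) \<le> f t0"
      by (rule coeff_norm_le_f_t0) (use 2 N in \<open>simp only: quad_scale, simp add: abs_mult\<close>)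
    then show ?thesis
      using 2 by (simp only: coeff_norm_scale) (simp add: field_simps N_def)
  qed
qed

section \<open>Extreme polynomials and the value of the constant\<close>

text \<open>\<open>(q, r)\<close> is a unit vector, with the sign \<open>s'\<close> absorbed into
  \<open>r\<close>. The polynomial, up to the sign \<open>s\<close>, is then both
  \<open>x\<^sup>2\<close> minus a square and a square minus \<open>y\<^sup>2\<close>, so it lies
  between -1 and 1 on the square.\<close>

lemma quad_norm_extreme:
  assumes t: "1/2 \<le> t" "t \<le> 1" and s: "\<bar>s\<bar> = 1" "\<bar>s'\<bar> = 1"
  shows "quad_norm (s * t) (s * (s' * (2 * sqrt (t * (1 - t))))) (s * (- t)) = 1"
proof -
  define q r where "q = sqrt t" and "r = s' * sqrt (1 - t)"
  have s2: "s'\<^sup>2 = 1" using s by (simp add: power2_eq_1_iff abs_if split: if_splits)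
  have q2: "q\<^sup>2 = t" and r2: "r\<^sup>2 = 1 - t"
    using t s2 by (simp_all add: q_def r_def power_mult_distrib)
  have b: "s' * (2 * sqrt (t * (1 - t))) = 2 * q * r"
    by (simp add: q_def r_def real_sqrt_mult)
  have up: "quad t (2 * q * r) (- t) x y = x\<^sup>2 - (r * x - q * y)\<^sup>2" for x y
  proof -
    have "(r * x - q * y)\<^sup>2 = r\<^sup>2 * x\<^sup>2 - 2 * q * r * x * y + q\<^sup>2 * y\<^sup>2"
      by (simp add: power2_eq_square algebra_simps)
    then show ?thesis unfolding q2 r2 by (simp add: quad_def algebra_simps)
  qed
  have lo: "quad t (2 * q * r) (- t) x y = (q * x + r * y)\<^sup>2 - y\<^sup>2" for x y
  proof -
    have "(q * x + r * y)\<^sup>2 = q\<^sup>2 * x\<^sup>2 + 2 * q * r * x * y + r\<^sup>2 * y\<^sup>2"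
      by (simp add: power2_eq_square algebra_simps)
    then show ?thesis unfolding q2 r2 by (simp add: quad_def algebra_simps)
  qed
  have "\<bar>quad t (2 * q * r) (- t) x y\<bar> \<le> 1" if "\<bar>x\<bar> \<le> 1" "\<bar>y\<bar> \<le> 1" for x y
    using that abs_square_le_1[of x] abs_square_le_1[of y] up[of x y] lo[of x y]
      zero_le_power2[of "r * x - q * y"] zero_le_power2[of "q * x + r * y"] by linarith
  moreover have "q > 0" using t by (simp add: q_def)
  \<comment> \<open>At \<open>(1, r / q)\<close> the subtracted square vanishes and the value 1 is
    attained; \<open>1/2 \<le> t\<close> keeps this point in the square.\<close>
  moreover have "\<bar>r / q\<bar> \<le> 1"
  proof -
    have "r\<^sup>2 \<le> q\<^sup>2" using t by (simp add: q2 r2)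
    then have "\<bar>r\<bar> \<le> q" using \<open>q > 0\<close> by (simp flip: abs_le_square_iff)
    then show ?thesis using \<open>q > 0\<close> by simp
  qed
  ultimately show ?thesis
    unfolding b using s
    by (intro quad_norm_eq_1I[of _ _ _ 1 "r / q"]) (simp_all only: quad_scale abs_mult, simp_all add: up)
qed

lemma coeff_norm_extreme:
  assumes t: "0 \<le> t" "t \<le> 1" and s: "\<bar>s\<bar> = 1" "\<bar>s'\<bar> = 1"
  shows "coeff_norm (s * t) (s * (s' * (2 * sqrt (t * (1 - t))))) (s * (- t)) = f t"
  unfolding coeff_norm_scale using assms by (simp add: coeff_norm_def f_def abs_mult)

text \<open>The infimum is attained: \<open>f t0\<close> is admissible, and testing any admissible
  \<open>D\<close> on the extreme polynomial with both signs positive gives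
  \<open>f t0 \<le> D\<close>.\<close>

lemma D_R2_2_eq: "D_R2_2 = f t0"
  unfolding D_R2_2_def
proof (rule cInf_eq_minimum)
  have "t0 powr (4/3) > 0" using t0_bounds by simp
  then have "g t0 > 0" unfolding g_def by (intro add_pos_nonneg) auto
  then have "f t0 > 0" using t0_bounds by (simp add: f_eq_g)
  then show "f t0 \<in> {D. D > 0 \<and> (\<forall>a b c. coeff_norm a b c \<le> D * quad_norm a b c)}"
    using coeff_norm_le_quad_norm by simp
next
  fix D assume "D \<in> {D. D > 0 \<and> (\<forall>a b c. coeff_norm a b c \<le> D * quad_norm a b c)}"
  then have "coeff_norm (1 * t0) (1 * (1 * (2 * sqrt (t0 * (1 - t0))))) (1 * (- t0))
      \<le> D * quad_norm (1 * t0) (1 * (1 * (2 * sqrt (t0 * (1 - t0))))) (1 * (- t0))"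
    by blast
  also have "quad_norm (1 * t0) (1 * (1 * (2 * sqrt (t0 * (1 - t0))))) (1 * (- t0)) = 1"
    using t0_bounds by (intro quad_norm_extreme) auto
  also have "coeff_norm (1 * t0) (1 * (1 * (2 * sqrt (t0 * (1 - t0))))) (1 * (- t0)) = f t0"
    using t0_bounds by (intro coeff_norm_extreme) auto
  finally show "f t0 \<le> D" by simp
qed

section \<open>Numerical value and closed form of \<open>f t0\<close>\<close>

text \<open>Cubing the two powers in \<open>g t0\<close>, and using
  \<open>f t0 ^ 4 = g t0 ^ 3\<close>, turns every estimate into an inequality between rationals. The
  decimals enclose the two powers, then their combination \<open>g t0\<close>, tightly enough for an
  error below 5/10^7.\<close>

lemma f_t0_bounds: "1.8373725 < f t0" "f t0 < 1.8373735"
proof -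
  have cube_less: "x ^ 3 < y ^ 3 \<Longrightarrow> 0 \<le> y \<Longrightarrow> x < y" for x y :: real
    by (rule power_less_imp_less_base)
  have A: "(t0 powr (4/3)) ^ 3 = t0 ^ 4"
    using powr_thirds_cube[of t0 4] t0_bounds by simp
  have B: "((4 * (t0 * (1 - t0))) powr (2/3)) ^ 3 = (4 * (t0 * (1 - t0)))\<^sup>2"
    using powr_thirds_cube[of "4 * (t0 * (1 - t0))" 2] t0_bounds by simp
  have F: "f t0 ^ 4 = g t0 ^ 3"
    using g_nonneg[of t0] t0_bounds
    by (cases "g t0 = 0") (simp_all add: f_eq_g powr_powr flip: powr_numeral powr_realpow)
  have "(82778280/10^8) ^ 3 < (86783528/10^8 :: real) ^ 4" by (simp add: power_divide)
  also have "\<dots> \<le> t0 ^ 4" using t0_bounds by (intro power_mono) auto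
  finally have Al: "82778280/10^8 < t0 powr (4/3)"
    unfolding A[symmetric] by (rule cube_less) simp
  have "t0 ^ 4 \<le> (867835281/10^9) ^ 4" using t0_bounds by (intro power_mono) auto
  also have "\<dots> < (82778284/10^8 :: real) ^ 3" by (simp add: power_divide)
  finally have Au: "t0 powr (4/3) < 82778284/10^8"
    unfolding A[symmetric] by (rule cube_less) simp
  \<comment> \<open>The factors \<open>t0\<close> and \<open>1 - t0\<close> are bounded separately,
    so the lower bound for the product uses both bounds for \<open>t0\<close>.\<close>
  have "(5948514/10^7) ^ 3 < (4 * (86783528/10^8 * (1 - 867835281/10^9)) :: real)\<^sup>2" by (simp add: power_divide)
  also have "\<dots> \<le> (4 * (t0 * (1 - t0)))\<^sup>2"
    using t0_bounds by (intro power_mono mult_left_mono mult_mono) auto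
  finally have Bl: "5948514/10^7 < (4 * (t0 * (1 - t0))) powr (2/3)"
    unfolding B[symmetric] by (rule cube_less) simp
  have "(4 * (t0 * (1 - t0)))\<^sup>2 \<le> (4 * (867835281/10^9 * (1 - 86783528/10^8)))\<^sup>2"
    using t0_bounds by (intro power_mono mult_left_mono mult_mono) auto
  also have "\<dots> < (5948516/10^7 :: real) ^ 3" by (simp add: power_divide)
  finally have Bu: "(4 * (t0 * (1 - t0))) powr (2/3) < 5948516/10^7"
    unfolding B[symmetric] by (rule cube_less) simp
  have gl: "22504170/10^7 < g t0" and gu: "g t0 < 22504173/10^7"
    using Al Au Bl Bu by (simp_all add: g_def)
  have "1.8373725 ^ 4 < (22504170/10^7 :: real) ^ 3" by (simp add: power_divide)
  also have "\<dots> \<le> f t0 ^ 4" unfolding F using gl by (intro power_mono) auto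
  finally show "1.8373725 < f t0"
    by (rule power_less_imp_less_base) (simp add: f_def)
  have "f t0 ^ 4 \<le> (22504173/10^7) ^ 3" unfolding F using gu g_nonneg by (intro power_mono) auto
  also have "\<dots> < 1.8373735 ^ 4" by (simp add: power_divide)
  finally show "f t0 < 1.8373735"
    by (rule power_less_imp_less_base) simp
qed

text \<open>The two summands are those of \<open>g t0\<close>: the long bracket is
  \<open>36 * t0\<close>, with \<open>36 powr (4/3) = 36 * 6 powr (2/3)\<close>, and
  \<open>X = - 81 * w\<close>, so that \<open>- (3 / X) = 1 / (27 * w)\<close> is positive and its
  power 2/3 is \<open>1 / (9 * w powr (2/3))\<close>.\<close>

lemma f_t0_exact:
  "f t0 = ((2 * root 3 (107 + 9 * sqrt 129) + root 3 (856 - 72 * sqrt 129) + 16) powr (4/3)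
            / (18 * 6 powr (2/3))
          + 1 / (9 * (- (3 / X)) powr (2/3))) powr (3/4)"
proof -
  define w where "w = 4 * (t0 * (1 - t0))"
  have w: "w > 0" using t0_bounds by (simp add: w_def)
  have "X = - 81 * w"
    unfolding w_def t0_cardano(2,3) by (simp add: power2_eq_square field_simps)
  then have "- (3 / X) = 1 / (3 ^ 3 * w)" using w by (simp add: field_simps)
  also have "\<dots> powr (2/3) = 1 / (9 * w powr (2/3))"
    using w by (simp add: powr_divide powr_mult powr_powr flip: powr_numeral)
  finally have B: "1 / (9 * (- (3 / X)) powr (2/3)) = w powr (2/3)" by simp
  have "(36 * t0) powr (4/3) = (6 powr 2) powr (4/3) * t0 powr (4/3)"
    using t0_bounds by (simp add: powr_mult)
  also have "(6 powr 2) powr (4/3) = 6 powr (2 + 2/3 :: real)"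
    by (simp only: powr_powr) simp
  also have "\<dots> = 36 * 6 powr (2/3)"
    by (subst powr_add) simp
  finally have "(36 * t0) powr (4/3) / (18 * 6 powr (2/3)) = 2 * t0 powr (4/3)"
    by simp
  moreover have "36 * t0 = 2 * root 3 (107 + 9 * sqrt 129) + root 3 (856 - 72 * sqrt 129) + 16"
    by (simp add: t0_def)
  ultimately show ?thesis
    unfolding B using t0_bounds by (simp add: f_eq_g g_def w_def)
qed

theorem theorem3p3:
  shows "D_R2_2 = f t0
    \<and> \<bar>t0 - 0.867835\<bar> < 5 / 10 ^ 7
    \<and> \<bar>f t0 - 1.837373\<bar> < 5 / 10 ^ 7
    \<and> f t0 =
        ((2 * root 3 (107 + 9 * sqrt 129) + root 3 (856 - 72 * sqrt 129) + 16) powr (4/3)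
            / (18 * 6 powr (2/3))
          + 1 / (9 * (- (3 / X)) powr (2/3))) powr (3/4)
    \<and> (\<forall>s \<in> {1, -1}. \<forall>s' \<in> {1, -1}.
          quad_norm (s * t0) (s * (s' * (2 * sqrt (t0 * (1 - t0))))) (s * (- t0)) = 1
        \<and> coeff_norm (s * t0) (s * (s' * (2 * sqrt (t0 * (1 - t0))))) (s * (- t0)) = D_R2_2)"
proof (intro conjI ballI)
  show "D_R2_2 = f t0" by (rule D_R2_2_eq)
  show "\<bar>t0 - 0.867835\<bar> < 5 / 10 ^ 7"
    using t0_bounds by (simp add: abs_less_iff)
  show "\<bar>f t0 - 1.837373\<bar> < 5 / 10 ^ 7"
    unfolding abs_less_iff using f_t0_bounds by simp
next
  fix s s' :: real assume "s \<in> {1, -1}" "s' \<in> {1, -1}"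
  then have s: "\<bar>s\<bar> = 1" "\<bar>s'\<bar> = 1" by auto
  have t: "1/2 \<le> t0" "0 \<le> t0" "t0 \<le> 1" using t0_bounds by auto
  show "quad_norm (s * t0) (s * (s' * (2 * sqrt (t0 * (1 - t0))))) (s * (- t0)) = 1"
    using t(1,3) s by (rule quad_norm_extreme)
  show "coeff_norm (s * t0) (s * (s' * (2 * sqrt (t0 * (1 - t0))))) (s * (- t0)) = D_R2_2"
    unfolding D_R2_2_eq using t(2,3) s by (rule coeff_norm_extreme)
qed (rule f_t0_exact)

end
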